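(* Let $\mathbb Z\langle X\rangle$ be the free unital associative ring on the countably infinite set $X=\{x_1,x_2,\dots\}$, and let $T^{(4)}$ be the two-sided ideal of $\mathbb Z\langle X\rangle$ generated by all commutators $[a_1,a_2,a_3,a_4]$ with $a_i\in\mathbb Z\langle X\rangle$. For $k\ge 1$ put \[v_k=[x_1,x_2][x_3,x_4]\cdots[x_{2k-1},x_{2k}]\,[x_{2k+1},x_{2k+2},x_{2k+3}].\] Then $v_k\notin T^{(4)}$ for all $k\ge 1$.
   Context: Commutators are left-normed: $[a,b]=ab-ba$, $[a_1,\dots,a_n]=[[a_1,\dots,a_{n-1}],a_n]$. *)

theory Defs
  imports Main
begin

text \<open>The free unital associative ring Z<X> on X = {x_i | i :: nat}: an element is a
  finitely supported function from words (lists of variable indices) to integer coefficients.\<close>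

type_synonym ncpoly = "nat list \<Rightarrow> int"

definition FR :: "ncpoly set" where
  "FR = {f. finite {w. f w \<noteq> 0}}"

definition ncadd :: "ncpoly \<Rightarrow> ncpoly \<Rightarrow> ncpoly" where
  "ncadd f g = (\<lambda>w. f w + g w)"

definition ncneg :: "ncpoly \<Rightarrow> ncpoly" where
  "ncneg f = (\<lambda>w. - f w)"

definition nczero :: ncpoly where
  "nczero = (\<lambda>w. 0)"

definition ncone :: ncpoly where
  "ncone = (\<lambda>w. if w = [] then 1 else 0)"

definition ncmul :: "ncpoly \<Rightarrow> ncpoly \<Rightarrow> ncpoly" where
  "ncmul f g = (\<lambda>w. \<Sum>i\<le>length w. f (take i w) * g (drop i w))"

definition ncvar :: "nat \<Rightarrow> ncpoly" where
  "ncvar i = (\<lambda>w. if w = [i] then 1 else 0)"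

definition ncsub :: "ncpoly \<Rightarrow> ncpoly \<Rightarrow> ncpoly" where
  "ncsub f g = ncadd f (ncneg g)"

definition comm :: "ncpoly \<Rightarrow> ncpoly \<Rightarrow> ncpoly" where
  "comm a b = ncsub (ncmul a b) (ncmul b a)"

definition comm3 :: "ncpoly \<Rightarrow> ncpoly \<Rightarrow> ncpoly \<Rightarrow> ncpoly" where
  "comm3 a b c = comm (comm a b) c"

definition comm4 :: "ncpoly \<Rightarrow> ncpoly \<Rightarrow> ncpoly \<Rightarrow> ncpoly \<Rightarrow> ncpoly" where
  "comm4 a b c d = comm (comm (comm a b) c) d"

inductive_set T4 :: "ncpoly set" where
  gen: "\<lbrakk>a1 \<in> FR; a2 \<in> FR; a3 \<in> FR; a4 \<in> FR\<rbrakk> \<Longrightarrow> comm4 a1 a2 a3 a4 \<in> T4"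
| zero: "nczero \<in> T4"
| add: "\<lbrakk>p \<in> T4; q \<in> T4\<rbrakk> \<Longrightarrow> ncadd p q \<in> T4"
| neg: "p \<in> T4 \<Longrightarrow> ncneg p \<in> T4"
| lmul: "\<lbrakk>a \<in> FR; p \<in> T4\<rbrakk> \<Longrightarrow> ncmul a p \<in> T4"
| rmul: "\<lbrakk>p \<in> T4; a \<in> FR\<rbrakk> \<Longrightarrow> ncmul p a \<in> T4"

definition ncprod :: "ncpoly list \<Rightarrow> ncpoly" where
  "ncprod xs = foldr ncmul xs ncone"

definition vk :: "nat \<Rightarrow> ncpoly" where
  "vk k = ncmul (ncprod (map (\<lambda>j. comm (ncvar (2*j - 1)) (ncvar (2*j))) [1..<k+1]))
                (comm3 (ncvar (2*k+1)) (ncvar (2*k+2)) (ncvar (2*k+3)))"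

end

theory Submission
  imports Defs "HOL-Library.Function_Algebras" "HOL-Library.Numeral_Type"
begin

text \<open>We give an additive functional on \<open>Z<X>\<close> that kills \<open>T\<^sup>(\<^sup>4\<^sup>)\<close> but not \<open>v\<^sub>k\<close>. Its values lie in
  a Grassmann ring of characteristic 3 with anticommuting generators \<open>e\<^sub>i\<close>. For a word \<open>w\<close> let
  \<open>hat w\<close> be the sum of the \<open>e\<^sub>i\<close> over its letters and \<open>gexp w\<close> the product of the factors
  \<open>1 + e\<^sub>i e\<^sub>j\<close> over all pairs of positions. The map \<open>gexp\<close> alone would send every triple commutator
  to 0. The functional is \<open>phi w = gexp w * cub w\<close>, where \<open>cub\<close> is a cubic element chosen such that
  \<open>cub (p x y q) - cub (p y x q) = - e\<^sub>x e\<^sub>y hat q\<close> for letters \<open>x, y\<close>; this is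
  consistent only modulo 3. It follows that \<open>phi\<close> sends \<open>u [a, b, c] v\<close> to
  \<open>- gexp (u a b c v) * hat a * hat b * hat c\<close>. Moving a word \<open>d\<close> from the right of \<open>a b c\<close> to
  its left changes \<open>gexp\<close> by a multiple of \<open>hat a + hat b + hat c\<close>, which is annihilated, so
  fourfold commutators vanish, while \<open>v\<^sub>k\<close> goes to plus or minus \<open>e\<^sub>1 e\<^sub>2 \<dots> e\<^sub>n\<close> with \<open>n = 2k + 3\<close>.\<close>

section \<open>Linear functionals on the free ring\<close>

text \<open>Additive extension from words to polynomials; \<open>'r\<close> need not be commutative,
  since integer coefficients are central.\<close>

definition ev :: "(nat list \<Rightarrow> 'r) \<Rightarrow> ncpoly \<Rightarrow> 'r::ring_1" where
  "ev \<phi> f = (\<Sum>w | f w \<noteq> 0. of_int (f w) * \<phi> w)"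

lemma ev_superset:
  assumes "finite W" "{w. f w \<noteq> 0} \<subseteq> W"
  shows "ev \<phi> f = (\<Sum>w\<in>W. of_int (f w) * \<phi> w)"
  unfolding ev_def using assms by (intro sum.mono_neutral_left) auto

lemma ev_zero_fun [simp]: "ev (\<lambda>w. 0) f = 0"
  by (simp add: ev_def)

lemma ev_diff_fun: "ev (\<lambda>w. \<phi> w - \<psi> w) f = ev \<phi> f - ev \<psi> f"
  by (simp add: ev_def algebra_simps sum_subtractf)

lemma ev_nczero [simp]: "ev \<phi> nczero = 0"
  by (simp add: ev_def nczero_def)

lemma FR_ncvar [simp, intro]: "ncvar i \<in> FR"
  by (simp add: FR_def ncvar_def)

lemma FR_ncone [simp, intro]: "ncone \<in> FR"
  by (simp add: FR_def ncone_def)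

lemma FR_nczero [simp, intro]: "nczero \<in> FR"
  by (simp add: FR_def nczero_def)

lemma FR_ncneg [simp, intro]: "f \<in> FR \<Longrightarrow> ncneg f \<in> FR"
  by (simp add: FR_def ncneg_def)

lemma FR_ncadd [simp, intro]:
  assumes "f \<in> FR" "g \<in> FR"
  shows "ncadd f g \<in> FR"
proof -
  have "{w. f w + g w \<noteq> 0} \<subseteq> {w. f w \<noteq> 0} \<union> {w. g w \<noteq> 0}" by auto
  then show ?thesis
    using assms unfolding FR_def ncadd_def by (simp add: finite_subset)
qed

lemma FR_ncsub [simp, intro]: "f \<in> FR \<Longrightarrow> g \<in> FR \<Longrightarrow> ncsub f g \<in> FR"
  by (simp add: ncsub_def)

lemma ev_ncvar [simp]: "ev \<phi> (ncvar i) = \<phi> [i]"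
  by (simp add: ev_def ncvar_def)

lemma ev_ncone [simp]: "ev \<phi> ncone = \<phi> []"
  by (simp add: ev_def ncone_def)

lemma ev_ncneg [simp]: "ev \<phi> (ncneg f) = - ev \<phi> f"
  by (simp add: ev_def ncneg_def sum_negf)

lemma ev_ncadd [simp]:
  assumes "f \<in> FR" "g \<in> FR"
  shows "ev \<phi> (ncadd f g) = ev \<phi> f + ev \<phi> g"
proof -
  let ?W = "{w. f w \<noteq> 0} \<union> {w. g w \<noteq> 0}"
  have fin: "finite ?W" using assms by (simp add: FR_def)
  have "ev \<phi> (ncadd f g) = (\<Sum>w\<in>?W. of_int (f w) * \<phi> w) + (\<Sum>w\<in>?W. of_int (g w) * \<phi> w)"
    by (subst ev_superset[OF fin]) (auto simp: ncadd_def algebra_simps sum.distrib)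
  also have "\<dots> = ev \<phi> f + ev \<phi> g"
    by (simp add: ev_superset[OF fin])
  finally show ?thesis .
qed

lemma ev_ncsub [simp]: "f \<in> FR \<Longrightarrow> g \<in> FR \<Longrightarrow> ev \<phi> (ncsub f g) = ev \<phi> f - ev \<phi> g"
  by (simp add: ncsub_def)

lemma ncmul_eq_sum_pairs:
  assumes "finite A" "{u. f u \<noteq> 0} \<subseteq> A" "finite B" "{v. g v \<noteq> 0} \<subseteq> B"
  shows "ncmul f g w = (\<Sum>(u, v) \<in> {p \<in> A \<times> B. fst p @ snd p = w}. f u * g v)"
proof -
  let ?P = "(\<lambda>i. (take i w, drop i w)) ` {..length w}"
  have inj: "inj_on (\<lambda>i. (take i w, drop i w)) {..length w}"
    by (rule inj_onI) (metis Pair_inject atMost_iff length_take min.absorb2)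
  have mem: "(u, v) \<in> ?P" if "u @ v = w" for u v
    using that by (intro image_eqI[of _ _ "length u"]) auto
  have "ncmul f g w = (\<Sum>(u, v) \<in> ?P. f u * g v)"
    by (simp add: ncmul_def sum.reindex[OF inj])
  also have "\<dots> = (\<Sum>(u, v) \<in> {p \<in> A \<times> B. fst p @ snd p = w}. f u * g v)"
    by (rule sum.mono_neutral_right) (use assms mem in auto)
  finally show ?thesis .
qed

text \<open>Grouping pairs of words by their concatenation turns products into nested
  \<open>ev\<close>, so identities on polynomials reduce to identities on words.\<close>

lemma
  assumes "f \<in> FR" "g \<in> FR"
  shows FR_ncmul [simp, intro]: "ncmul f g \<in> FR"
    and ev_ncmul: "ev \<phi> (ncmul f g) = ev (\<lambda>u. ev (\<lambda>v. \<phi> (u @ v)) g) f"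
proof -
  let ?A = "{u. f u \<noteq> 0}" and ?B = "{v. g v \<noteq> 0}"
  let ?W = "(\<lambda>p. fst p @ snd p) ` (?A \<times> ?B)"
  have fin: "finite ?A" "finite ?B" using assms by (simp_all add: FR_def)
  then have finW: "finite ?W" by simp
  note pairs = ncmul_eq_sum_pairs[OF fin(1) order.refl fin(2) order.refl]
  have sub: "{w. ncmul f g w \<noteq> 0} \<subseteq> ?W"
  proof
    fix w assume "w \<in> {w. ncmul f g w \<noteq> 0}"
    then have "{p \<in> ?A \<times> ?B. fst p @ snd p = w} \<noteq> {}"
      unfolding mem_Collect_eq pairs by (metis sum.empty)
    then show "w \<in> ?W" by blast
  qed
  then show "ncmul f g \<in> FR"
    using finW unfolding FR_def by (simp add: finite_subset)
  have "ev \<phi> (ncmul f g) = (\<Sum>w\<in>?W. of_int (ncmul f g w) * \<phi> w)"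
    by (rule ev_superset[OF finW sub])
  also have "\<dots> = (\<Sum>w\<in>?W. \<Sum>p\<in>{p \<in> ?A \<times> ?B. fst p @ snd p = w}.
      of_int (f (fst p) * g (snd p)) * \<phi> (fst p @ snd p))"
    by (intro sum.cong refl) (auto simp: pairs sum_distrib_right split_def intro!: sum.cong)
  also have "\<dots> = (\<Sum>p\<in>?A \<times> ?B. of_int (f (fst p) * g (snd p)) * \<phi> (fst p @ snd p))"
    using fin by (intro sum.image_gen[symmetric]) simp
  also have "\<dots> = ev (\<lambda>u. ev (\<lambda>v. \<phi> (u @ v)) g) f"
    by (simp add: ev_def sum.cartesian_product split_def sum_distrib_left mult.assoc)
  finally show "ev \<phi> (ncmul f g) = ev (\<lambda>u. ev (\<lambda>v. \<phi> (u @ v)) g) f" .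
qed

lemma ev_swap: "ev (\<lambda>u. ev (\<lambda>v. \<phi> u v) g) f = ev (\<lambda>v. ev (\<lambda>u. \<phi> u v) f) g"
proof -
  have c: "of_int (f u) * (of_int (g v) * \<phi> u v) = of_int (g v) * (of_int (f u) * \<phi> u v)" for u v
    by (metis mult.assoc mult_of_int_commute)
  show ?thesis
    unfolding ev_def sum_distrib_left by (subst sum.swap) (simp add: c)
qed

section \<open>Commutators and the ideal \<open>T4\<close>\<close>

lemma FR_comm [simp, intro]: "f \<in> FR \<Longrightarrow> g \<in> FR \<Longrightarrow> comm f g \<in> FR"
  by (simp add: comm_def)

lemma FR_comm4 [simp, intro]:
  "a \<in> FR \<Longrightarrow> b \<in> FR \<Longrightarrow> c \<in> FR \<Longrightarrow> d \<in> FR \<Longrightarrow> comm4 a b c d \<in> FR"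
  by (simp add: comm4_def)

lemma FR_ncprod [intro]: "set fs \<subseteq> FR \<Longrightarrow> ncprod fs \<in> FR"
  by (induction fs) (auto simp: ncprod_def)

lemma ev_comm:
  assumes "f \<in> FR" "g \<in> FR"
  shows "ev \<phi> (comm f g) = ev (\<lambda>u. ev (\<lambda>v. \<phi> (u @ v) - \<phi> (v @ u)) g) f"
  using assms by (simp add: comm_def ev_ncmul ev_diff_fun ev_swap[of "\<lambda>v u. \<phi> (v @ u)"])

text \<open>The value of \<open>\<phi>\<close> on u[a,b,c]v for words.\<close>

definition wcomm3 ::
  "(nat list \<Rightarrow> 'r::ring_1) \<Rightarrow> nat list \<Rightarrow> nat list \<Rightarrow> nat list \<Rightarrow> nat list \<Rightarrow> nat list \<Rightarrow> 'r" where
  "wcomm3 \<phi> u a b c v =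
     (\<phi> (u @ a @ b @ c @ v) - \<phi> (u @ b @ a @ c @ v)) -
     (\<phi> (u @ c @ a @ b @ v) - \<phi> (u @ c @ b @ a @ v))"

lemma ev_comm3:
  assumes "a \<in> FR" "b \<in> FR" "c \<in> FR"
  shows "ev (\<lambda>w. \<phi> (u @ w @ v)) (comm3 a b c) =
    ev (\<lambda>a. ev (\<lambda>b. ev (\<lambda>c. wcomm3 \<phi> u a b c v) c) b) a"
  using assms by (simp add: comm3_def ev_comm wcomm3_def ev_diff_fun)

lemma ev_comm4:
  assumes "a \<in> FR" "b \<in> FR" "c \<in> FR" "d \<in> FR"
  shows "ev (\<lambda>w. \<phi> (u @ w @ v)) (comm4 a b c d) =
    ev (\<lambda>a. ev (\<lambda>b. ev (\<lambda>c. ev (\<lambda>d.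
      wcomm3 \<phi> u a b c (d @ v) - wcomm3 \<phi> (u @ d) a b c v) d) c) b) a"
  using assms by (simp add: comm4_def ev_comm wcomm3_def ev_diff_fun)

lemma ev_T4_eq_0:
  assumes "\<And>u a b c d v. wcomm3 \<phi> u a b c (d @ v) = wcomm3 \<phi> (u @ d) a b c v"
    and "f \<in> T4"
  shows "ev \<phi> f = 0"
proof -
  \<comment> \<open>Arbitrary words on both sides make the claim stable under left and right
    multiplication.\<close>
  have "f \<in> FR \<and> (\<forall>u v. ev (\<lambda>w. \<phi> (u @ w @ v)) f = 0)"
    using assms(2)
  proof induction
    case (gen a1 a2 a3 a4)
    then show ?case by (simp add: ev_comm4 assms(1))
  next
    case (lmul a p)
    have "ev (\<lambda>w. \<phi> (u @ w @ v)) (ncmul a p) = 0" for u v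
    proof -
      have "ev (\<lambda>w2. \<phi> (u @ w1 @ w2 @ v)) p = 0" for w1
        using lmul.IH[THEN conjunct2, rule_format, of "u @ w1" v] by simp
      then show ?thesis using lmul by (simp add: ev_ncmul)
    qed
    then show ?case using lmul by simp
  next
    case (rmul p a)
    have "ev (\<lambda>w. \<phi> (u @ w @ v)) (ncmul p a) = 0" for u v
      using rmul by (simp add: ev_ncmul ev_swap[of _ a])
    then show ?case using rmul by simp
  qed auto
  from this[THEN conjunct2, rule_format, of "[]" "[]"] show ?thesis by simp
qed

section \<open>A functional with values in a Grassmann ring of characteristic three\<close>

locale grassmann_char3 =
  fixes e :: "nat \<Rightarrow> 'r::ring_1"
  assumes e_anticomm: "e i * e j = - (e j * e i)"
    and e_square: "e i * e i = 0"
    and char3: "(x::'r) + x + x = 0"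
begin

lemma double: "(x::'r) + x = - x"
  using char3[of x] by (simp add: eq_neg_iff_add_eq_0)

definition hat :: "nat list \<Rightarrow> 'r" where
  "hat w = sum_list (map e w)"

lemma hat_simps [simp]: "hat [] = 0" "hat (x # w) = e x + hat w" "hat (u @ v) = hat u + hat v"
  by (simp_all add: hat_def)

lemma e_hat_anticomm: "e x * hat w = - (hat w * e x)"
  by (induction w) (simp_all add: algebra_simps e_anticomm[of x])

lemma hat_anticomm: "hat u * hat w = - (hat w * hat u)"
  by (induction u) (simp_all add: algebra_simps e_hat_anticomm)

lemma hat_square: "hat w * hat w = 0"
  by (induction w) (simp_all add: algebra_simps e_square e_hat_anticomm)

lemma hat_square_left: "hat w * (hat w * z) = 0"
  by (simp add: mult.assoc[symmetric] hat_square)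

lemma hat_anticomm_left: "hat u * (hat w * z) = - (hat w * (hat u * z))"
  by (metis hat_anticomm mult.assoc mult_minus_left)

lemma e_anticomm_left: "e i * (e j * z) = - (e j * (e i * z))"
  by (metis e_anticomm mult.assoc mult_minus_left)

lemma e_hat_anticomm_left: "e i * (hat w * z) = - (hat w * (e i * z))"
  by (metis e_hat_anticomm mult.assoc mult_minus_left)

lemma e_square_left: "e i * (e i * z) = 0"
  by (simp add: mult.assoc[symmetric] e_square)

section \<open>Pair sums and the product \<open>gexp\<close>\<close>

fun pairs :: "nat list \<Rightarrow> 'r" where
  "pairs [] = 0"
| "pairs (x # w) = e x * hat w + pairs w"

lemma pairs_append: "pairs (u @ v) = pairs u + pairs v + hat u * hat v"
  by (induction u) (simp_all add: algebra_simps)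

fun gexp :: "nat list \<Rightarrow> 'r" where
  "gexp [] = 1"
| "gexp (x # w) = (1 + e x * hat w) * gexp w"

text \<open>Applied to products of two \<open>hat\<close> values, which are even, and to
  \<open>gexp\<close> itself.\<close>

lemma gexp_central:
  assumes "\<And>i. z * e i = e i * z"
  shows "z * gexp w = gexp w * z"
proof -
  have h: "z * hat w = hat w * z" for w
    by (induction w) (simp_all add: algebra_simps assms)
  have eh: "z * (e x * hat w) = e x * hat w * z" for x w
    by (metis assms h mult.assoc)
  show ?thesis
  proof (induction w)
    case (Cons x w)
    have "z * ((1 + e x * hat w) * gexp w) = (1 + e x * hat w) * (z * gexp w)"
      by (metis (no_types) eh distrib_left distrib_right mult.assoc mult.left_neutral mult.right_neutral)
    then show ?case by (simp add: Cons mult.assoc)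
  qed simp
qed

lemma hat2_e: "hat u * hat v * e i = e i * (hat u * hat v)"
  by (simp add: mult.assoc e_hat_anticomm_left e_hat_anticomm)

lemma hat2_gexp: "hat u * hat v * gexp w = gexp w * (hat u * hat v)"
  by (rule gexp_central) (rule hat2_e)

lemma gexp_e: "gexp w * e i = e i * gexp w"
proof (induction w)
  case (Cons x w)
  have "e x * hat w * e i = e i * (e x * hat w)"
    using hat2_e[of "[x]" w i] by simp
  then have "(1 + e x * hat w) * e i = e i * (1 + e x * hat w)"
    by (simp add: algebra_simps)
  then show ?case by (simp add: mult.assoc Cons) (simp add: mult.assoc[symmetric])
qed simp

lemma gexp_commute: "gexp u * gexp w = gexp w * gexp u"
  by (rule gexp_central) (rule gexp_e)

text \<open>Cross pairs contribute the factors 1 + e_x V with V = \<open>hat v\<close>; as V V = 0,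
  products of two terms e_x V vanish, leaving 1 + \<open>hat u * hat v\<close>.\<close>

lemma gexp_append: "gexp (u @ v) = gexp u * gexp v * (1 + hat u * hat v)"
proof (induction u)
  case (Cons x u)
  let ?U = "hat u" and ?V = "hat v"
  have "(1 + e x * (?U + ?V)) * (1 + ?U * ?V) = (1 + e x * ?U) * (1 + (e x + ?U) * ?V)"
    by (simp add: algebra_simps hat_square_left hat_square e_square_left e_square
        hat_anticomm_left[of v u] e_hat_anticomm[of x] e_hat_anticomm_left[of x])
  then have *: "(1 + e x * (?U + ?V)) * ((1 + ?U * ?V) * z) =
      (1 + e x * ?U) * ((1 + (e x + ?U) * ?V) * z)" for z
    by (simp only: mult.assoc[symmetric])
  have c: "gexp u * (gexp v * (1 + hat w * ?V)) = (1 + hat w * ?V) * (gexp u * gexp v)" for w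
    using hat2_gexp[of w v u] hat2_gexp[of w v v]
    by (simp add: distrib_left distrib_right) (metis mult.assoc)
  have "gexp ((x # u) @ v) = (1 + e x * (?U + ?V)) * ((1 + ?U * ?V) * (gexp u * gexp v))"
    by (simp add: Cons.IH mult.assoc c)
  also have "\<dots> = (1 + e x * ?U) * (gexp u * (gexp v * (1 + hat (x # u) * ?V)))"
    unfolding * c by simp
  finally show ?case by (simp add: mult.assoc)
qed simp

lemma gexp_swap:
  "gexp (u @ a @ b @ v) - gexp (u @ b @ a @ v) = - (gexp (u @ a @ b @ v) * (hat a * hat b))"
proof -
  define A B V U where "A = hat a" "B = hat b" "V = hat v" "U = hat u"
  note defs = A_B_V_U_def
  have anti: "B * A = - (A * B)" "B * (A * z) = - (A * (B * z))"
    "V * A = - (A * V)" "V * (A * z) = - (A * (V * z))"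
    "V * B = - (B * V)" "V * (B * z) = - (B * (V * z))"
    "U * A = - (A * U)" "U * (A * z) = - (A * (U * z))"
    "U * B = - (B * U)" "U * (B * z) = - (B * (U * z))"
    "A * A = 0" "A * (A * z) = 0" "B * B = 0" "B * (B * z) = 0" "V * V = 0" "V * (V * z) = 0" for z
    unfolding defs by (rule hat_anticomm hat_anticomm_left hat_square hat_square_left)+
  have gabv: "gexp (a @ b @ v) = gexp a * gexp b * gexp v * (1 + A * B + A * V + B * V)"
    by (simp add: gexp_append defs[symmetric] mult.assoc) (simp add: algebra_simps anti)
  have gbav: "gexp (b @ a @ v) = gexp a * gexp b * gexp v * (1 - A * B + A * V + B * V)"
    by (simp add: gexp_append defs[symmetric] mult.assoc[symmetric] gexp_commute[of b a])
      (simp add: algebra_simps anti)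
  define X where "X = 1 + U * (A + B + V)"
  have 1: "gexp (u @ a @ b @ v) =
      gexp u * gexp a * gexp b * gexp v * ((1 + A * B + A * V + B * V) * X)"
    by (simp add: gexp_append[of u] gabv defs[symmetric] X_def mult.assoc add.assoc)
  have 2: "gexp (u @ b @ a @ v) =
      gexp u * gexp a * gexp b * gexp v * ((1 - A * B + A * V + B * V) * X)"
    by (simp add: gexp_append[of u] gbav defs[symmetric] X_def mult.assoc add_ac)
  \<comment> \<open>The orders differ only in the sign of A B; then 2 = -1, and multiplying by A B
    kills all other terms containing A or B.\<close>
  have "(1 + A * B + A * V + B * V) * X - (1 - A * B + A * V + B * V) * X
      = A * B * (1 + U * V) + A * B * (1 + U * V)"
    by (simp add: X_def algebra_simps anti)
  also have "\<dots> = - (A * B * (1 + U * V))" by (rule double)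
  also have "\<dots> = - ((1 + A * B + A * V + B * V) * X * (A * B))"
    by (simp add: X_def algebra_simps anti)
  finally show ?thesis
    unfolding 1 2 defs[symmetric] right_diff_distrib[symmetric] mult.assoc
    by (simp only: mult_minus_right mult.assoc)
qed

text \<open>For distinct letters, \<open>cub w\<close> is the sum over all triples of letters of \<open>w\<close> of their product in
  increasing order, weighted by the rank (0, 1 or 2) of the letter occurring first in \<open>w\<close>; the
  weights 1 and 2 become equal once the first letter is moved to the front, because \<open>2 = - 1\<close>.
  Modulo 3 the rank makes the swap rule \<open>cub_swap\<close> one-sided: it involves the letters to the right
  of the transposed pair only, which is impossible in characteristic 0.\<close>

definition spair :: "nat \<Rightarrow> nat \<Rightarrow> nat \<Rightarrow> 'r" where
  "spair x y z = (if min y z < x then e (min y z) * e (max y z) else 0)"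

fun below :: "nat \<Rightarrow> nat list \<Rightarrow> 'r" where
  "below x [] = 0"
| "below x (y # w) = below x w + (\<Sum>z\<leftarrow>w. spair x y z)"

fun cub :: "nat list \<Rightarrow> 'r" where
  "cub [] = 0"
| "cub (x # w) = cub w - e x * below x w"

lemma spair_commute: "spair x y z = spair x z y"
  by (simp add: spair_def min.commute max.commute)

text \<open>Later letters enter only as unordered pairs, so letters in front of a transposition drop
  out of \<open>cub_swap\<close>.\<close>

lemma below_swap: "below z (p @ x # y # q) = below z (p @ y # x # q)"
  by (induction p) (simp_all add: spair_commute add_ac)

lemma spair_exchange: "e y * spair y x z - e x * spair x y z = - (e x * e y * e z)"
proof -
  have *: "e y * spair y x z - e x * spair x y z = - (e x * e y * e z)" if "x < y" for x y
  proof (cases x z rule: linorder_cases)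
    case less
    with that have "\<not> min y z < x" "min x z = x" "max x z = z" by auto
    with that show ?thesis
      by (simp add: spair_def e_anticomm_left[of y x] mult.assoc)
  next
    case equal
    with that show ?thesis
      by (simp add: spair_def e_anticomm[of y z] e_square e_square_left mult.assoc)
  next
    case greater
    \<comment> \<open>With z below both letters the two terms agree instead of cancelling; here 2 =
      -1 is used.\<close>
    with that have "e y * spair y x z - e x * spair x y z = e x * (e y * e z) + e x * (e y * e z)"
      by (simp add: spair_def e_anticomm[of z] e_anticomm_left[of y x])
    then show ?thesis by (simp add: double mult.assoc)
  qed
  show ?thesis
  proof (cases x y rule: linorder_cases)
    case greater
    then show ?thesis
      using *[of y x] by (simp add: e_anticomm[of y x] algebra_simps)
  qed (use * in \<open>simp_all add: e_square\<close>)
qed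

lemma cub_swap: "cub (p @ x # y # q) - cub (p @ y # x # q) = - (e x * e y * hat q)"
proof (induction p)
  case Nil
  have "e y * (\<Sum>z\<leftarrow>q. spair y x z) - e x * (\<Sum>z\<leftarrow>q. spair x y z) = - (e x * e y * hat q)"
  proof (induction q)
    case (Cons z q)
    have "e y * (\<Sum>z\<leftarrow>z # q. spair y x z) - e x * (\<Sum>z\<leftarrow>z # q. spair x y z) =
      (e y * spair y x z - e x * spair x y z) +
      (e y * (\<Sum>z\<leftarrow>q. spair y x z) - e x * (\<Sum>z\<leftarrow>q. spair x y z))"
      by (simp add: algebra_simps)
    then show ?case
      unfolding spair_exchange Cons.IH by (simp add: algebra_simps)
  qed simp
  then show ?case by (simp add: algebra_simps)
next
  case (Cons z p)
  then show ?case by (simp add: below_swap[of z p x y q])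
qed

text \<open>While x passes through b, each letter y of b contributes e_x e_y times the
  \<open>hat\<close> of what follows y; these sum to the two terms.\<close>

lemma cub_swap_letter:
  "cub (p @ x # b @ q) - cub (p @ b @ x # q) = - (e x * (hat b * hat q + pairs b))"
proof (induction b arbitrary: p)
  case (Cons y b)
  have "cub (p @ x # (y # b) @ q) - cub (p @ (y # b) @ x # q) =
    (cub (p @ x # y # b @ q) - cub (p @ y # x # b @ q)) +
    (cub ((p @ [y]) @ x # b @ q) - cub ((p @ [y]) @ b @ x # q))" by simp
  also have "\<dots> = - (e x * e y * hat (b @ q)) - e x * (hat b * hat q + pairs b)"
    unfolding cub_swap Cons.IH by simp
  finally show ?case by (simp add: algebra_simps)
qed simp

lemma cub_swap_words:
  "cub (p @ a @ b @ q) - cub (p @ b @ a @ q) =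
     hat b * pairs a - hat a * pairs b - hat a * hat b * hat q"
proof (induction a arbitrary: p)
  case (Cons x a)
  have "cub (p @ (x # a) @ b @ q) - cub (p @ b @ (x # a) @ q) =
    (cub ((p @ [x]) @ a @ b @ q) - cub ((p @ [x]) @ b @ a @ q)) +
    (cub (p @ x # b @ (a @ q)) - cub (p @ b @ x # (a @ q)))" by simp
  also have "\<dots> = (hat b * pairs a - hat a * pairs b - hat a * hat b * hat q)
      - e x * (hat b * hat (a @ q) + pairs b)"
    unfolding cub_swap_letter Cons.IH by simp
  finally show ?case
    by (simp add: algebra_simps e_hat_anticomm_left[of x b])
qed simp

section \<open>The functional \<open>phi\<close> on commutators\<close>

definition phi :: "nat list \<Rightarrow> 'r" where
  "phi w = gexp w * cub w"

lemma phi_swap: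
  "phi (u @ a @ b @ v) - phi (u @ b @ a @ v) =
    gexp (u @ a @ b @ v) *
      (hat b * pairs a - hat a * pairs b - hat a * hat b * hat v - hat a * hat b * cub (u @ a @ b @ v))"
proof -
  define E E' where "E = gexp (u @ a @ b @ v)" "E' = gexp (u @ b @ a @ v)"
  define D where "D = hat b * pairs a - hat a * pairs b - hat a * hat b * hat v"
  have E': "E' = E + E * (hat a * hat b)"
    using gexp_swap[of u a b v] unfolding E_E'_def by (simp add: algebra_simps)
  \<comment> \<open>Hence D may be multiplied by \<open>gexp\<close> of either order.\<close>
  have "hat a * hat b * D = 0"
    by (simp add: D_def algebra_simps hat_square_left hat_anticomm_left[of b a])
  then have E'D: "E' * D = E * D"
    by (simp add: E' distrib_right mult.assoc)
  have "phi (u @ a @ b @ v) - phi (u @ b @ a @ v)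
      = (E - E') * cub (u @ a @ b @ v) + E' * (cub (u @ a @ b @ v) - cub (u @ b @ a @ v))"
    by (simp add: phi_def E_E'_def algebra_simps)
  also have "\<dots> = - (E * (hat a * hat b)) * cub (u @ a @ b @ v) + E * D"
    unfolding cub_swap_words D_def[symmetric] E'D by (simp add: E')
  finally show ?thesis by (simp add: E_E'_def D_def algebra_simps)
qed

text \<open>The surviving term comes from the one-sided tail in \<open>cub_swap\<close>: swapping a
  and b sees \<open>c @ v\<close> behind them in one half and only \<open>v\<close> in the
  other.\<close>

lemma wcomm3_phi: "wcomm3 phi u a b c v = - (gexp (u @ a @ b @ c @ v) * (hat a * hat b * hat c))"
proof -
  define A B C V where "A = hat a" "B = hat b" "C = hat c" "V = hat v"
  define E E' where "E = gexp (u @ a @ b @ c @ v)" "E' = gexp (u @ c @ a @ b @ v)"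
  define G G' where "G = cub (u @ a @ b @ c @ v)" "G' = cub (u @ c @ a @ b @ v)"
  define P where "P = B * pairs a - A * pairs b"
  have anti: "B * A = - (A * B)" "B * (A * z) = - (A * (B * z))"
    "C * A = - (A * C)" "C * (A * z) = - (A * (C * z))"
    "C * B = - (B * C)" "C * (B * z) = - (B * (C * z))"
    "A * A = 0" "A * (A * z) = 0" "B * B = 0" "B * (B * z) = 0" "C * C = 0" "C * (C * z) = 0" for z
    unfolding A_B_C_V_def by (rule hat_anticomm hat_anticomm_left hat_square hat_square_left)+
  have E': "E' = E + E * ((A + B) * C)"
    using gexp_swap[of u "a @ b" c v] by (simp add: E_E'_def A_B_C_V_def algebra_simps)
  have G: "G - G' = C * (pairs a + pairs b + A * B) - (A + B) * pairs c - (A + B) * C * V"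
    using cub_swap_words[of u "a @ b" c v] by (simp add: G_G'_def A_B_C_V_def pairs_append)
  have "wcomm3 phi u a b c v =
      E * (P - A * B * (C + V) - A * B * G) - E' * (P - A * B * V - A * B * G')"
    using phi_swap[of u a b "c @ v"] phi_swap[of "u @ c" a b v]
    by (simp add: wcomm3_def E_E'_def G_G'_def A_B_C_V_def P_def)
  also have "\<dots> = E * ((P - A * B * (C + V) - A * B * G) -
      (P - A * B * V - A * B * G') - (A + B) * C * (P - A * B * V - A * B * G'))"
    unfolding E' by (simp add: algebra_simps)
  also have "(P - A * B * (C + V) - A * B * G) - (P - A * B * V - A * B * G')
      - (A + B) * C * (P - A * B * V - A * B * G') = - (A * B * (G - G')) - A * B * C - (A + B) * C * P"
    by (simp add: algebra_simps anti)
  \<comment> \<open>The \<open>pairs a\<close> and \<open>pairs b\<close> terms of G - G' cancel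
    against those of P; the rest of G - G' is killed by A B.\<close>
  also have "\<dots> = - (A * B * C)"
    unfolding G P_def by (simp add: algebra_simps anti)
  finally show ?thesis by (simp add: E_E'_def A_B_C_V_def)
qed

lemma phi_T4: "f \<in> T4 \<Longrightarrow> ev phi f = 0"
proof (rule ev_T4_eq_0)
  fix u a b c d v
  have "gexp (u @ (a @ b @ c) @ d @ v) * (hat a * hat b * hat c) -
      gexp (u @ d @ (a @ b @ c) @ v) * (hat a * hat b * hat c) =
      - (gexp (u @ (a @ b @ c) @ d @ v) * (hat (a @ b @ c) * hat d * (hat a * hat b * hat c)))"
    using gexp_swap[of u "a @ b @ c" d v]
    by (simp only: left_diff_distrib[symmetric] mult_minus_left mult.assoc)
  also have "hat (a @ b @ c) * hat d * (hat a * hat b * hat c) = 0"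
    by (simp add: algebra_simps hat_square_left hat_square hat_anticomm[of d]
       hat_anticomm_left[of d] hat_anticomm_left[of b a]
       hat_anticomm_left[of c a] hat_anticomm_left[of c b])
  finally show "wcomm3 phi u a b c (d @ v) = wcomm3 phi (u @ d) a b c v"
    by (simp add: wcomm3_phi)
qed

section \<open>The value of \<open>phi\<close> on \<open>vk\<close>\<close>

lemma gexp_prod: "gexp w * prod_list (map e w) = prod_list (map e w)"
proof (induction w)
  case (Cons x w)
  \<comment> \<open>Corrections in \<open>gexp\<close> repeat a letter of the product and therefore
    vanish.\<close>
  have "e x * hat w * e x = 0"
    using e_hat_anticomm_left[of x w "e x"] by (simp add: mult.assoc e_square)
  then have x: "(1 + e x * hat w) * e x = e x" by (simp add: algebra_simps)
  have "gexp (x # w) * prod_list (map e (x # w)) =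
      (1 + e x * hat w) * (gexp w * e x) * prod_list (map e w)"
    by (simp add: mult.assoc)
  also have "\<dots> = (1 + e x * hat w) * e x * (gexp w * prod_list (map e w))"
    unfolding gexp_e by (simp add: mult.assoc)
  finally show ?case unfolding Cons.IH x by simp
qed simp

text \<open>Once the triple commutator is evaluated only \<open>gexp\<close> remains, and
  \<open>gexp_swap\<close> gives a factor - e_i e_j per commutator.\<close>

lemma ev_comm_product:
  "ev (\<lambda>w. gexp (u @ w @ t) * z) (ncprod (map (\<lambda>j. comm (ncvar (f j)) (ncvar (g j))) js)) =
    (- 1) ^ length js * gexp (u @ concat (map (\<lambda>j. [f j, g j]) js) @ t) *
      prod_list (map e (concat (map (\<lambda>j. [f j, g j]) js))) * z"
proof (induction js arbitrary: u)
  case Nil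
  then show ?case by (simp add: ncprod_def)
next
  case (Cons j js)
  let ?p = "ncprod (map (\<lambda>j. comm (ncvar (f j)) (ncvar (g j))) js)"
  let ?W = "concat (map (\<lambda>j. [f j, g j]) js)"
  have p: "?p \<in> FR" by (rule FR_ncprod) auto
  have "ev (\<lambda>w. gexp (u @ w @ t) * z) (ncmul (comm (ncvar (f j)) (ncvar (g j))) ?p) =
      ev (\<lambda>w. gexp ((u @ [f j, g j]) @ w @ t) * z) ?p -
      ev (\<lambda>w. gexp ((u @ [g j, f j]) @ w @ t) * z) ?p"
    using p by (simp add: ev_ncmul ev_comm)
  also have "\<dots> = (- 1) ^ length js *
      (gexp (u @ [f j] @ [g j] @ ?W @ t) - gexp (u @ [g j] @ [f j] @ ?W @ t)) *
      prod_list (map e ?W) * z"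
    unfolding Cons.IH by (simp add: algebra_simps)
  also have "\<dots> = (- 1) ^ length (j # js) * gexp (u @ [f j] @ [g j] @ ?W @ t) * (e (f j) * e (g j)) *
      prod_list (map e ?W) * z"
    unfolding gexp_swap by (simp add: mult.assoc)
  finally show ?case by (simp add: ncprod_def mult.assoc)
qed

lemma phi_vk: "ev phi (vk k) = - ((- 1) ^ k * prod_list (map e [1..<2 * k + 4]))"
proof -
  define js where "js = [1..<k + 1]"
  have len: "length js = k" by (simp add: js_def)
  let ?fs = "map (\<lambda>j. comm (ncvar (2 * j - 1)) (ncvar (2 * j))) js"
  let ?t = "[2 * k + 1, 2 * k + 2, 2 * k + 3]"
  let ?W = "concat (map (\<lambda>j. [2 * j - 1, 2 * j]) js)"
  have "?W = [1..<2 * k + 1]"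
    unfolding js_def by (induction k) auto
  moreover have "[1..<2 * k + 4] = [1..<2 * k + 1] @ ?t"
    using upt_add_eq_append[of 1 "2 * k + 1" 3] by (simp add: eval_nat_numeral)
  ultimately have W: "?W @ ?t = [1..<2 * k + 4]" by simp
  have F: "ncprod ?fs \<in> FR" by (rule FR_ncprod) auto
  have "ev (\<lambda>v. phi (u @ v)) (comm3 (ncvar (2 * k + 1)) (ncvar (2 * k + 2)) (ncvar (2 * k + 3)))
     = - (gexp ([] @ u @ ?t) * prod_list (map e ?t))" for u
    using ev_comm3[of "ncvar (2 * k + 1)" "ncvar (2 * k + 2)" "ncvar (2 * k + 3)" phi u "[]"]
    by (simp add: wcomm3_phi mult.assoc)
  then have "ev phi (vk k) = ev (\<lambda>u. gexp ([] @ u @ ?t) * (- prod_list (map e ?t))) (ncprod ?fs)"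
    using F unfolding vk_def js_def[symmetric] by (subst ev_ncmul) (auto simp: comm3_def)
  also have "\<dots> = - ((- 1) ^ k * (gexp (?W @ ?t) * prod_list (map e (?W @ ?t))))"
    unfolding ev_comm_product len by (simp add: mult.assoc)
  finally show ?thesis unfolding gexp_prod W .
qed

end

section \<open>A faithful Grassmann ring\<close>

text \<open>Additive operators over Z/3: composition supplies the associative product, and no
  exterior algebra has to be multiplied out.\<close>

typedef endo3 = "{F :: (nat set \<Rightarrow> 3) \<Rightarrow> (nat set \<Rightarrow> 3). \<forall>f g. F (f + g) = F f + F g}"
  morphisms app Endo
  by (rule exI[of _ id]) simp

setup_lifting type_definition_endo3

instantiation endo3 :: ring_1
begin

lift_definition zero_endo3 :: endo3 is "\<lambda>f. 0" by simp
lift_definition one_endo3 :: endo3 is "\<lambda>f. f" by simp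
lift_definition plus_endo3 :: "endo3 \<Rightarrow> endo3 \<Rightarrow> endo3" is "\<lambda>F G f. F f + G f"
  by (simp add: add_ac)
lift_definition uminus_endo3 :: "endo3 \<Rightarrow> endo3" is "\<lambda>F f. - F f" by simp
lift_definition minus_endo3 :: "endo3 \<Rightarrow> endo3 \<Rightarrow> endo3" is "\<lambda>F G f. F f - G f"
  by (simp add: algebra_simps)
lift_definition times_endo3 :: "endo3 \<Rightarrow> endo3 \<Rightarrow> endo3" is "\<lambda>F G f. F (G f)" by simp

instance
proof
  show "(0::endo3) \<noteq> 1"
  proof transfer
    show "(\<lambda>f. 0) \<noteq> (\<lambda>f :: nat set \<Rightarrow> 3. f)"
      by (auto dest: fun_cong[of _ _ "1"])
  qed
qed (transfer; simp add: fun_eq_iff add_ac)+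

end

text \<open>Functions on sets of letters stand for (infinite) sums of basis vectors of the exterior
  algebra, and \<open>ext i\<close> is left exterior multiplication by the letter \<open>i\<close>.\<close>

definition ext_sign :: "nat \<Rightarrow> nat set \<Rightarrow> 3" where
  "ext_sign i S = (- 1) ^ card {j \<in> S. j < i}"

lift_definition ext :: "nat \<Rightarrow> endo3" is
  "\<lambda>i f S. if i \<in> S then ext_sign i S * f (S - {i}) else 0"
  by (auto simp: fun_eq_iff algebra_simps)

lemma ext_sign_remove_greater: "i < j \<Longrightarrow> ext_sign i (S - {j}) = ext_sign i S"
  unfolding ext_sign_def by (rule arg_cong[where f = "\<lambda>A. (- 1) ^ card A"]) auto

lemma ext_sign_remove_less:
  assumes "i < j" "i \<in> S"
  shows "ext_sign j (S - {i}) = - ext_sign j S"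
proof -
  have "{k \<in> S. k < j} = insert i {k \<in> S - {i}. k < j}" using assms by auto
  then have "card {k \<in> S. k < j} = Suc (card {k \<in> S - {i}. k < j})" by simp
  then show ?thesis by (simp add: ext_sign_def)
qed

text \<open>Removing the smaller letter flips the sign of the larger one, but not
  conversely.\<close>

lemma ext_anticomm_less: "i < j \<Longrightarrow> ext i * ext j = - (ext j * ext i)"
  by transfer
    (auto simp: fun_eq_iff ext_sign_remove_greater ext_sign_remove_less
       Diff_insert2[symmetric] insert_commute intro!: arg_cong[where f = "\<lambda>x. _ * x"])

interpretation ext: grassmann_char3 ext
proof
  show square: "ext i * ext i = 0" for i
    by transfer (auto simp: fun_eq_iff)
  show "ext i * ext j = - (ext j * ext i)" for i j
    using ext_anticomm_less[of i j] ext_anticomm_less[of j i] square[of i]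
    by (cases i j rule: linorder_cases) simp_all
  have "(3::3) = 0"
    by (simp add: Rep_bit1_inject[symmetric] bit1.Rep_numeral bit1.Rep_0)
  moreover have "(c::3) + c + c = 3 * c" for c
    by simp
  ultimately have "(c::3) + c + c = 0" for c
    by (metis mult_zero_left)
  then show "x + x + x = 0" for x :: endo3
    by transfer (simp add: fun_eq_iff)
qed

text \<open>Applied to the unit of the exterior algebra, the product has coefficient 1 or -1 at
  \<open>set w\<close>.\<close>

lemma ext_prod_nonzero:
  "distinct w \<Longrightarrow> app (prod_list (map ext w)) (\<lambda>S. if S = {} then 1 else 0) (set w) \<noteq> 0"
proof (induction w)
  case Nil
  then show ?case by (simp add: one_endo3.rep_eq)
next
  case (Cons x w)
  have "ext_sign x S * c \<noteq> 0" if "c \<noteq> 0" for S c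
    using that by (simp add: ext_sign_def minus_one_power_iff)
  then show ?case using Cons by (simp add: times_endo3.rep_eq ext.rep_eq)
qed

theorem theorem1p1:
  fixes k :: nat
  assumes "k \<ge> 1"
  shows "vk k \<notin> T4"
proof
  assume "vk k \<in> T4"
  then have "(- 1) ^ k * prod_list (map ext [1..<2 * k + 4]) = 0"
    using ext.phi_T4[of "vk k"] ext.phi_vk[of k] by simp
  then have "prod_list (map ext [1..<2 * k + 4]) = 0"
    by (simp add: minus_one_power_iff split: if_splits)
  then show False
    using ext_prod_nonzero[of "[1..<2 * k + 4]"] by (simp add: zero_endo3.rep_eq)
qed

end
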